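(* Let $\mathcal{C}$ be a prevariety of languages over a finite alphabet $A$. Then $\mathit{SD}(\mathcal{C}) = \mathit{SF}(\mathcal{C})$.
   Context: Fix a finite alphabet $A$; $A^*$ is the set of finite words (with empty word $\varepsilon$), $A^+=A^*\setminus\{\varepsilon\}$, and a language is a subset of $A^*$. A class is a set of languages. A prevariety is a class $\mathcal{C}$ of regular languages containing $\emptyset$ and $A^*$, closed under union, intersection and complement, and closed under quotients: for all $L\in\mathcal{C}$ and $u\in A^*$, the languages $u^{-1}L=\{w \mid uw\in L\}$ and $Lu^{-1}=\{w\mid wu\in L\}$ belong to $\mathcal{C}$. The star-free closure $\mathit{SF}(\mathcal{C})$ is the least class containing $\mathcal{C}$ and all singletons $\{a\}$ for $a\in A$, and closed under union, complement ($K\mapsto A^*\setminus K$) and concatenation ($KL=\{uv\mid u\in K, v\in L\}$). A prefix code is a language $K\subseteq A^+$ with $K\cap KA^+=\emptyset$. For an integer $d\ge 1$, a prefix code $K$ has synchronization delay $d$ if for all $u,v,w\in A^*$, $uvw\in K^+$ and $v\in K^d$ imply $uv\in K^+$; it has bounded synchronization delay if it has synchronization delay $d$ for some $d\ge1$. A concatenation $KL$ is unambiguous if whenever $u,u'\in K$, $v,v'\in L$ and $uv=u'v'$, then $u=u'$ and $v=v'$. $\mathit{SD}(\mathcal{C})$ is the least class containing $\emptyset$ and $\{a\}$ for every $a\in A$, and closed under: intersection with languages of $\mathcal{C}$ (if $K\in\mathit{SD}(\mathcal{C})$ and $L\in\mathcal{C}$ then $K\cap L\in\mathit{SD}(\mathcal{C})$);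 union of disjoint languages; unambiguous concatenation; and Kleene star $K^*$ of languages $K\in\mathit{SD}(\mathcal{C})$ that are prefix codes of bounded synchronization delay. *)

theory Defs
  imports Main
begin

text \<open>Words over the finite alphabet (the type 'a, of class finite) are lists;
  a language is a set of lists. The alphabet A is UNIV :: 'a set, so A^* is UNIV.\<close>

definition conc :: "'a list set \<Rightarrow> 'a list set \<Rightarrow> 'a list set" (infixr "@@" 75) where
  "K @@ L = {u @ v | u v. u \<in> K \<and> v \<in> L}"

fun lpow :: "'a list set \<Rightarrow> nat \<Rightarrow> 'a list set" where
  "lpow K 0 = {[]}"
| "lpow K (Suc n) = K @@ lpow K n"

definition lstar :: "'a list set \<Rightarrow> 'a list set" where
  "lstar K = (\<Union>n. lpow K n)"

definition lplus :: "'a list set \<Rightarrow> 'a list set" where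
  "lplus K = (\<Union>n\<in>{1..}. lpow K n)"

inductive regular :: "'a list set \<Rightarrow> bool" where
  reg_empty: "regular {}"
| reg_eps: "regular {[]}"
| reg_letter: "regular {[a]}"
| reg_union: "regular K \<Longrightarrow> regular L \<Longrightarrow> regular (K \<union> L)"
| reg_conc: "regular K \<Longrightarrow> regular L \<Longrightarrow> regular (K @@ L)"
| reg_star: "regular K \<Longrightarrow> regular (lstar K)"

definition lquot :: "'a list \<Rightarrow> 'a list set \<Rightarrow> 'a list set" where
  "lquot u L = {w. u @ w \<in> L}"

definition rquot :: "'a list set \<Rightarrow> 'a list \<Rightarrow> 'a list set" where
  "rquot L u = {w. w @ u \<in> L}"

definition prevariety :: "('a::finite) list set set \<Rightarrow> bool" where
  "prevariety C \<longleftrightarrow>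
     (\<forall>L\<in>C. regular L) \<and> {} \<in> C \<and> UNIV \<in> C \<and>
     (\<forall>K\<in>C. \<forall>L\<in>C. K \<union> L \<in> C) \<and>
     (\<forall>K\<in>C. \<forall>L\<in>C. K \<inter> L \<in> C) \<and>
     (\<forall>L\<in>C. - L \<in> C) \<and>
     (\<forall>L\<in>C. \<forall>u. lquot u L \<in> C \<and> rquot L u \<in> C)"

inductive_set SF :: "('a::finite) list set set \<Rightarrow> 'a list set set" for C where
  SF_base: "L \<in> C \<Longrightarrow> L \<in> SF C"
| SF_letter: "{[a]} \<in> SF C"
| SF_union: "K \<in> SF C \<Longrightarrow> L \<in> SF C \<Longrightarrow> K \<union> L \<in> SF C"
| SF_compl: "K \<in> SF C \<Longrightarrow> - K \<in> SF C"
| SF_conc: "K \<in> SF C \<Longrightarrow> L \<in> SF C \<Longrightarrow> K @@ L \<in> SF C"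

definition prefix_code :: "'a list set \<Rightarrow> bool" where
  "prefix_code K \<longleftrightarrow> [] \<notin> K \<and> K \<inter> (K @@ (UNIV - {[]})) = {}"

definition sync_delay :: "'a list set \<Rightarrow> nat \<Rightarrow> bool" where
  "sync_delay K d \<longleftrightarrow> prefix_code K \<and> d \<ge> 1 \<and>
     (\<forall>u v w. u @ v @ w \<in> lplus K \<and> v \<in> lpow K d \<longrightarrow> u @ v \<in> lplus K)"

definition bounded_sync_delay :: "'a list set \<Rightarrow> bool" where
  "bounded_sync_delay K \<longleftrightarrow> (\<exists>d\<ge>1. sync_delay K d)"

definition unambiguous :: "'a list set \<Rightarrow> 'a list set \<Rightarrow> bool" where
  "unambiguous K L \<longleftrightarrow>
     (\<forall>u\<in>K. \<forall>u'\<in>K. \<forall>v\<in>L. \<forall>v'\<in>L. u @ v = u' @ v' \<longrightarrow> u = u' \<and> v = v')"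

inductive_set SD :: "('a::finite) list set set \<Rightarrow> 'a list set set" for C where
  SD_empty: "{} \<in> SD C"
| SD_letter: "{[a]} \<in> SD C"
| SD_inter: "K \<in> SD C \<Longrightarrow> L \<in> C \<Longrightarrow> K \<inter> L \<in> SD C"
| SD_union: "K \<in> SD C \<Longrightarrow> L \<in> SD C \<Longrightarrow> K \<inter> L = {} \<Longrightarrow> K \<union> L \<in> SD C"
| SD_conc: "K \<in> SD C \<Longrightarrow> L \<in> SD C \<Longrightarrow> unambiguous K L \<Longrightarrow> K @@ L \<in> SD C"
| SD_star: "K \<in> SD C \<Longrightarrow> prefix_code K \<Longrightarrow> bounded_sync_delay K \<Longrightarrow> lstar K \<in> SD C"

end

theory Submission
  imports Defs "HOL-Library.FuncSet" "HOL-Library.Disjoint_Sets"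
begin

text \<open>\<open>SD \<subseteq> SF\<close>: splitting off prefixes in a prefix code \<open>K\<close> as long as possible leaves a
  remainder \<open>z\<close> that is nonempty exactly for the words outside \<open>K\<^sup>*\<close>. If \<open>K\<close> has
  synchronization delay \<open>d\<close>, only the last \<open>d\<close> of the removed prefixes need to be known, so
  that no star is needed to describe the complement of \<open>K\<^sup>*\<close>.

  \<open>SF \<subseteq> SD\<close>: for \<open>L\<close> in \<open>SF(C)\<close> there is a finite \<open>T \<subseteq> C\<close>, closed under left quotients, such
  that every word \<open>w\<close> acting idempotently on \<open>T\<close> satisfies \<open>w\<^sup>n \<equiv> w\<^sup>n\<^sup>+\<^sup>1\<close> in the syntactic
  congruence of \<open>L\<close> for some \<open>n\<close>. Let a prefix code \<open>P\<close> of bounded delay act on a set \<open>S\<close> of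
  left quotients of \<open>L\<close>. Assume first that all words of \<open>P\<close> permute \<open>S\<close>, that \<open>u\<close> and \<open>v\<close> in
  \<open>P\<^sup>*\<close> act alike on \<open>T\<close>, and that \<open>u\<^sup>m\<close> acts idempotently on \<open>T\<close>. Then so does \<open>v u\<^sup>m\<^sup>-\<^sup>1\<close>;
  both words permute \<open>S\<close>, hence fix it pointwise, and \<open>u\<close> and \<open>v\<close> act alike on \<open>S\<close>.
  Intersecting \<open>P\<^sup>*\<close> with languages of \<open>C\<close> therefore separates the actions on \<open>S\<close>. Otherwise
  let \<open>R\<close> be the set of words of \<open>P\<close> acting as a fixed non-permutation \<open>r\<close>, and \<open>K = P - R\<close>.
  Then \<open>P\<^sup>* = (K\<^sup>* R)\<^sup>* K\<^sup>*\<close>, where \<open>K\<close> has fewer actions than \<open>P\<close> and \<open>K\<^sup>* R\<close> acts on a proper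
  subset of \<open>S\<close>.\<close>


section \<open>Concatenation and iteration\<close>

lemma concI [intro]: "u \<in> K \<Longrightarrow> v \<in> L \<Longrightarrow> u @ v \<in> K @@ L"
  by (auto simp: conc_def)

lemma concE [elim!]:
  assumes "w \<in> K @@ L"
  obtains u v where "u \<in> K" "v \<in> L" "w = u @ v"
  using assms by (auto simp: conc_def)

lemma conc_mono: "K \<subseteq> K' \<Longrightarrow> L \<subseteq> L' \<Longrightarrow> K @@ L \<subseteq> K' @@ L'"
  by blast

lemma conc_assoc: "(K @@ L) @@ M = K @@ (L @@ M)"
proof (intro equalityI subsetI)
  fix w assume "w \<in> K @@ (L @@ M)"
  then obtain u v x where "u \<in> K" "v \<in> L" "x \<in> M" "w = (u @ v) @ x"
    by auto
  then show "w \<in> (K @@ L) @@ M"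
    by blast
qed fastforce

lemma conc_Un_left: "(K \<union> L) @@ M = K @@ M \<union> L @@ M"
  by blast

lemma conc_Un_right: "K @@ (L \<union> M) = K @@ L \<union> K @@ M"
  by blast

lemma conc_UN_left: "(\<Union>i\<in>I. F i) @@ L = (\<Union>i\<in>I. F i @@ L)"
  by blast

lemma conc_UN_right: "K @@ (\<Union>i\<in>I. F i) = (\<Union>i\<in>I. K @@ F i)"
  by blast

lemma conc_empty_left [simp]: "{} @@ L = {}"
  by blast

lemma conc_eps_left [simp]: "{[]} @@ L = L"
  by (auto simp: conc_def)

lemma conc_eps_right [simp]: "L @@ {[]} = L"
  by (auto simp: conc_def)

lemma subset_conc_left: "[] \<in> L \<Longrightarrow> K \<subseteq> K @@ L"
  by (metis append_Nil2 concI subsetI)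

lemma subset_conc_right: "[] \<in> K \<Longrightarrow> L \<subseteq> K @@ L"
  by (metis append_Nil concI subsetI)

lemma lpow_add: "lpow K (m + n) = lpow K m @@ lpow K n"
  by (induction m) (simp_all add: conc_assoc)

lemma lpow_mono: "K \<subseteq> L \<Longrightarrow> lpow K n \<subseteq> lpow L n"
  by (induction n) (simp_all add: conc_mono)

lemma lpow_subset_lstar: "lpow K n \<subseteq> lstar K"
  unfolding lstar_def by blast

lemma subset_lstar: "K \<subseteq> lstar K"
  using lpow_subset_lstar[of K 1] by simp

lemma Nil_in_lstar [simp, intro]: "[] \<in> lstar K"
  using lpow_subset_lstar[of K 0] by simp

lemma lstar_append: "x \<in> lstar K \<Longrightarrow> y \<in> lstar K \<Longrightarrow> x @ y \<in> lstar K"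
  unfolding lstar_def by (metis UN_E UN_I UNIV_I concI lpow_add)

lemma lstar_induct [consumes 1, case_names Nil append]:
  assumes "w \<in> lstar K" "P []"
    and "\<And>k x. k \<in> K \<Longrightarrow> x \<in> lstar K \<Longrightarrow> P x \<Longrightarrow> P (k @ x)"
  shows "P w"
proof -
  have "\<forall>w\<in>lpow K n. P w" for n
  proof (induction n)
    case (Suc n)
    then show ?case
      using assms(3) lpow_subset_lstar by fastforce
  qed (simp add: assms(2))
  then show ?thesis
    using assms(1) by (auto simp: lstar_def)
qed

lemma lstar_unfold: "lstar K = {[]} \<union> K @@ lstar K"
proof (intro equalityI subsetI)
  show "w \<in> {[]} \<union> K @@ lstar K" if "w \<in> lstar K" for w
    using that by (induction rule: lstar_induct) auto
qed (use subset_lstar lstar_append in blast)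

lemma lstar_empty [simp]: "lstar {} = {[]}"
  by (subst lstar_unfold) auto

lemma lstar_subset_lstar:
  assumes "K \<subseteq> lstar L"
  shows "lstar K \<subseteq> lstar L"
proof
  show "w \<in> lstar L" if "w \<in> lstar K" for w
    using that by (induction rule: lstar_induct) (use assms lstar_append in auto)
qed

lemma lstar_mono: "K \<subseteq> L \<Longrightarrow> lstar K \<subseteq> lstar L"
  by (meson lstar_subset_lstar subset_lstar subset_trans)

lemma lstar_conc_lstar [simp]: "lstar K @@ lstar K = lstar K"
  using subset_conc_left[OF Nil_in_lstar] lstar_append by blast

lemma lstar_conc_commute: "lstar K @@ K = K @@ lstar K"
proof -
  have "lpow K n @@ K = K @@ lpow K n" for n
    using lpow_add[of K n 1] by simp
  then show ?thesis
    by (simp add: lstar_def conc_UN_left conc_UN_right)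
qed

lemma lstar_split_lpow: "lstar K = (\<Union>i<d. lpow K i) \<union> lstar K @@ lpow K d"
proof (intro equalityI subsetI)
  fix w assume "w \<in> lstar K"
  then obtain n where power: "w \<in> lpow K n"
    by (auto simp: lstar_def)
  show "w \<in> (\<Union>i<d. lpow K i) \<union> lstar K @@ lpow K d"
  proof (cases "n < d")
    case False
    then have "w \<in> lpow K (n - d) @@ lpow K d"
      using power by (simp flip: lpow_add)
    then show ?thesis
      using lpow_subset_lstar by blast
  qed (use power in blast)
qed (use lpow_subset_lstar lstar_append in blast)

lemma lstar_Un_denest: "lstar (K \<union> L) = lstar (lstar K @@ L) @@ lstar K"
proof (intro equalityI subsetI)
  let ?X = "lstar (lstar K @@ L) @@ lstar K"
  have unfold: "?X = lstar K \<union> lstar K @@ L @@ ?X"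
    using conc_Un_left[of "{[]}"] lstar_unfold[of "lstar K @@ L"]
    by (metis conc_assoc conc_eps_left)
  have "L @@ ?X \<subseteq> lstar K @@ L @@ ?X"
    by (rule subset_conc_right) simp
  also have "\<dots> \<subseteq> ?X"
    using unfold by blast
  finally have prepend_L: "L @@ ?X \<subseteq> ?X" .
  have "lstar K @@ ?X = ?X"
    by (subst (1 2) unfold) (simp add: conc_Un_right flip: conc_assoc)
  then have prepend_K: "K @@ ?X \<subseteq> ?X"
    using conc_mono[OF subset_lstar[of K] subset_refl[of ?X]] by simp
  show "w \<in> ?X" if "w \<in> lstar (K \<union> L)" for w
    using that by (induction rule: lstar_induct) (use prepend_K prepend_L unfold in auto)
next
  have "lstar K \<subseteq> lstar (K \<union> L)" "L \<subseteq> lstar (K \<union> L)"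
    using lstar_mono[of K "K \<union> L"] subset_lstar[of "K \<union> L"] by auto
  moreover from this have "lstar (lstar K @@ L) \<subseteq> lstar (K \<union> L)"
    using lstar_append by (intro lstar_subset_lstar) blast
  ultimately show "w \<in> lstar (K \<union> L)" if "w \<in> lstar (lstar K @@ L) @@ lstar K" for w
    using that lstar_append by blast
qed

lemma lpow_lstar_conc_subset: "lpow (lstar K @@ L) n \<subseteq> lstar (K \<union> L) @@ lpow (K \<union> L) n"
proof (induction n)
  case (Suc n)
  let ?P = "K \<union> L"
  have "lpow (lstar K @@ L) (Suc n) \<subseteq> (lstar ?P @@ ?P) @@ lstar ?P @@ lpow ?P n"
    using Suc by (simp add: conc_mono lstar_mono)
  also have "\<dots> = (lstar ?P @@ lstar ?P) @@ ?P @@ lpow ?P n"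
    using lstar_conc_commute[of ?P] by (metis conc_assoc)
  finally show ?case
    by simp
qed simp


section \<open>Prefix codes and synchronization delay\<close>

lemma prefix_code_Nil: "prefix_code K \<Longrightarrow> [] \<notin> K"
  by (simp add: prefix_code_def)

lemma prefix_code_iff:
  "prefix_code K \<longleftrightarrow> [] \<notin> K \<and> (\<forall>k\<in>K. \<forall>k'\<in>K. \<forall>x y. k @ x = k' @ y \<longrightarrow> k = k')"
    (is "_ \<longleftrightarrow> _ \<and> ?unique")
proof -
  have "?unique \<longleftrightarrow> K \<inter> K @@ (UNIV - {[]}) = {}"
  proof
    assume ?unique
    then show "K \<inter> K @@ (UNIV - {[]}) = {}"
      by (auto simp: conc_def) (metis append_Nil2 append_self_conv)
  next
    assume "K \<inter> K @@ (UNIV - {[]}) = {}"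
    then have "c = []" if "k \<in> K" "k @ c \<in> K" for k c
      using that by blast
    then show ?unique
      by (fastforce simp: append_eq_append_conv2)
  qed
  then show ?thesis
    by (simp add: prefix_code_def)
qed

lemma prefix_code_append_eq:
  assumes "prefix_code K" "k \<in> K" "k' \<in> K" "k @ x = k' @ y"
  shows "k = k'" "x = y"
  using assms unfolding prefix_code_iff by blast+

lemma prefix_code_subset: "prefix_code K \<Longrightarrow> K' \<subseteq> K \<Longrightarrow> prefix_code K'"
  unfolding prefix_code_iff by blast

lemma prefix_code_lstar_append:
  assumes "prefix_code K" "K' \<subseteq> K" "x \<in> lstar K" "x @ y \<in> lstar K'"
  shows "x \<in> lstar K' \<and> y \<in> lstar K'"
  using assms(3,4)
proof (induction rule: lstar_induct)
  case (append k x)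
  have "k \<noteq> []"
    using append.hyps assms(1) prefix_code_Nil by blast
  with append.prems obtain k' z where "k' \<in> K'" "z \<in> lstar K'" "k @ x @ y = k' @ z"
    by (subst (asm) lstar_unfold) auto
  moreover from this have "k = k'" "x @ y = z"
    using prefix_code_append_eq[OF assms(1)] append.hyps(1) assms(2) by blast+
  ultimately show ?case
    using append.IH subset_lstar lstar_append by blast
qed simp

lemma lstar_left_unitary:
  "prefix_code K \<Longrightarrow> x \<in> lstar K \<Longrightarrow> x @ y \<in> lstar K \<Longrightarrow> y \<in> lstar K"
  using prefix_code_lstar_append by blast

lemma sync_delay_iff:
  "sync_delay K d \<longleftrightarrow> prefix_code K \<and> d \<ge> 1 \<and>
    (\<forall>u v w. v \<in> lpow K d \<longrightarrow> u @ v @ w \<in> lstar K \<longrightarrow> u @ v \<in> lstar K)"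
proof (cases "prefix_code K \<and> d \<ge> 1")
  case True
  have Nil_notin: "[] \<notin> lpow K n" if "n \<ge> 1" for n
    using that True prefix_code_Nil by (cases n) auto
  have "(UNIV :: nat set) = insert 0 {1..}"
    by auto
  then have "lstar K = insert [] (lplus K)"
    unfolding lstar_def lplus_def by (metis UN_insert lpow.simps(1) insert_is_Un)
  moreover have "[] \<notin> lplus K"
    using Nil_notin by (auto simp: lplus_def)
  ultimately show ?thesis
    using True Nil_notin[of d] unfolding sync_delay_def by auto
qed (auto simp: sync_delay_def)

lemma bounded_sync_delay_iff: "bounded_sync_delay K \<longleftrightarrow> (\<exists>d. sync_delay K d)"
  by (auto simp: bounded_sync_delay_def sync_delay_def)

lemma sync_delay_subset:
  assumes "sync_delay K d" "K' \<subseteq> K"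
  shows "sync_delay K' d"
  unfolding sync_delay_iff
proof (intro conjI allI impI)
  have code: "prefix_code K" and "d \<ge> 1"
    using assms(1) by (auto simp: sync_delay_iff)
  show "prefix_code K'" "d \<ge> 1"
    using code assms(2) prefix_code_subset \<open>d \<ge> 1\<close> by blast+
  fix u v w assume "v \<in> lpow K' d" and in_lstar: "u @ v @ w \<in> lstar K'"
  then have "v \<in> lpow K d" "u @ v @ w \<in> lstar K"
    using lpow_mono[OF assms(2)] lstar_mono[OF assms(2)] by blast+
  then have "u @ v \<in> lstar K"
    using assms(1) unfolding sync_delay_iff by blast
  then show "u @ v \<in> lstar K'"
    using prefix_code_lstar_append[OF code assms(2), of "u @ v" w] in_lstar by simp
qed

lemma bounded_sync_delay_subset:
  "bounded_sync_delay K \<Longrightarrow> K' \<subseteq> K \<Longrightarrow> bounded_sync_delay K'"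
  unfolding bounded_sync_delay_iff using sync_delay_subset by blast

lemma bounded_sync_delay_prefix_code: "bounded_sync_delay K \<Longrightarrow> prefix_code K"
  by (auto simp: bounded_sync_delay_iff sync_delay_iff)

lemma sync_delay_empty: "sync_delay {} 1"
  by (auto simp: sync_delay_iff prefix_code_iff)

lemma lstar_letters: "lstar (range (\<lambda>a. [a])) = UNIV"
proof -
  have "w \<in> lstar (range (\<lambda>a. [a]))" for w :: "'a list"
  proof (induction w)
    case (Cons a w)
    then have "[a] @ w \<in> lstar (range (\<lambda>a. [a]))"
      using subset_lstar[of "range (\<lambda>a. [a])"] by (intro lstar_append) auto
    then show ?case
      by simp
  qed simp
  then show ?thesis
    by blast
qed

lemma sync_delay_letters: "sync_delay (range (\<lambda>a. [a])) 1"
  by (auto simp: sync_delay_iff prefix_code_iff lstar_letters)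


section \<open>Unambiguous concatenation and return words\<close>

lemma unambiguousD:
  "unambiguous K L \<Longrightarrow> u \<in> K \<Longrightarrow> u' \<in> K \<Longrightarrow> v \<in> L \<Longrightarrow> v' \<in> L \<Longrightarrow> u @ v = u' @ v'
    \<Longrightarrow> u = u' \<and> v = v'"
  unfolding unambiguous_def by blast

lemma prefix_code_unambiguous: "prefix_code K \<Longrightarrow> unambiguous K L"
  unfolding unambiguous_def using prefix_code_append_eq by blast

lemma unambiguous_subset: "unambiguous K L \<Longrightarrow> K' \<subseteq> K \<Longrightarrow> L' \<subseteq> L \<Longrightarrow> unambiguous K' L'"
  unfolding unambiguous_def by blast

lemma unambiguous_conc_disjoint:
  assumes "unambiguous K L" "K' \<subseteq> K" "K'' \<subseteq> K" "L' \<subseteq> L" "L'' \<subseteq> L" "K' \<inter> K'' = {}"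
  shows "(K' @@ L') \<inter> (K'' @@ L'') = {}"
proof (rule equals0I)
  fix w assume "w \<in> (K' @@ L') \<inter> (K'' @@ L'')"
  then obtain u v u' v' where "u \<in> K'" "v \<in> L'" "u' \<in> K''" "v' \<in> L''" "u @ v = u' @ v'"
    by (metis IntE concE)
  moreover from this have "u = u'"
    using unambiguousD[OF assms(1), of u u' v v'] assms(2-5) by blast
  ultimately show False
    using assms(6) by blast
qed

lemma unambiguous_lstar:
  assumes "prefix_code K" "L \<inter> K @@ UNIV = {}"
  shows "unambiguous (lstar K) L"
proof -
  have extension_Nil: "c = []" if "u \<in> lstar K" "u @ c \<in> lstar K" "c @ v \<in> L" for u c v
  proof (rule ccontr)
    assume "c \<noteq> []"
    moreover have "c \<in> lstar K"
      using lstar_left_unitary[OF assms(1)] that by blast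
    ultimately obtain k x where "c @ v = k @ (x @ v)" "k \<in> K"
      by (subst (asm) lstar_unfold) auto
    then have "c @ v \<in> K @@ UNIV"
      by (metis UNIV_I concI)
    then show False
      using assms(2) that(3) by (meson disjoint_iff)
  qed
  have "u = u'"
    if "u \<in> lstar K" "u' \<in> lstar K" "v \<in> L" "v' \<in> L" "u @ v = u' @ v'" for u u' v v'
  proof -
    from that(5) consider c where "u' = u @ c" "v = c @ v'" | c where "u = u' @ c" "v' = c @ v"
      by (auto simp: append_eq_append_conv2)
    then show ?thesis
      by cases (use that extension_Nil in auto)
  qed
  then show ?thesis
    unfolding unambiguous_def by blast
qed

context
  fixes K L :: "'a list set"
  assumes code: "prefix_code (K \<union> L)" and disjoint: "K \<inter> L = {}"
begin

lemma unambiguous_lstar_conc_UNIV: "unambiguous (lstar K) (L @@ UNIV)"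
proof (rule unambiguous_lstar)
  show "prefix_code K"
    using code prefix_code_subset by blast
  show "(L @@ UNIV) \<inter> K @@ UNIV = {}"
    using prefix_code_append_eq(1)[OF code] disjoint by blast
qed

lemma unambiguous_return_words: "unambiguous (lstar K) L"
  using unambiguous_subset[OF unambiguous_lstar_conc_UNIV subset_refl] subset_conc_left by blast

lemma prefix_code_return_words: "prefix_code (lstar K @@ L)"
  unfolding prefix_code_iff
proof (intro conjI ballI allI impI)
  show "[] \<notin> lstar K @@ L"
    using prefix_code_Nil[OF code] by auto
  fix w w' x y
  assume "w \<in> lstar K @@ L" "w' \<in> lstar K @@ L" and prefixes: "w @ x = w' @ y"
  then obtain u v u' v' where w: "u \<in> lstar K" "v \<in> L" "w = u @ v"
    and w': "u' \<in> lstar K" "v' \<in> L" "w' = u' @ v'"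
    by (elim concE) (rule that)
  then have "u = u' \<and> v @ x = v' @ y"
    using prefixes by (intro unambiguousD[OF unambiguous_lstar_conc_UNIV]) auto
  moreover from this have "v = v'"
    using prefix_code_append_eq(1)[OF code, of v v' x y] w(2) w'(2) by simp
  ultimately show "w = w'"
    using w w' by simp
qed

lemma lstar_disjoint_return_words: "lstar K \<inter> (lstar K @@ L) @@ UNIV = {}"
proof (rule equals0I)
  fix w assume "w \<in> lstar K \<inter> (lstar K @@ L) @@ UNIV"
  then obtain x v y where factors: "x \<in> lstar K" "v \<in> L" "x @ v @ y \<in> lstar K"
    by auto
  have "v @ y \<in> lstar K"
    using factors lstar_left_unitary prefix_code_subset[OF code] by blast
  moreover have "v \<noteq> []"
    using factors prefix_code_Nil[OF code] by blast
  ultimately obtain k z where "k \<in> K" "v @ y = k @ z"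
    by (subst (asm) lstar_unfold) auto
  then show False
    using prefix_code_append_eq(1)[OF code] disjoint factors(2) by blast
qed

lemma unambiguous_lstar_return_words: "unambiguous (lstar (lstar K @@ L)) (lstar K)"
  by (rule unambiguous_lstar[OF prefix_code_return_words lstar_disjoint_return_words])

end

lemma sync_delay_return_words:
  assumes "sync_delay (K \<union> L) d" "K \<inter> L = {}"
  shows "sync_delay (lstar K @@ L) (Suc d)"
  unfolding sync_delay_iff
proof (intro conjI allI impI)
  let ?P = "K \<union> L" and ?R = "lstar K @@ L"
  show "prefix_code ?R"
    using assms prefix_code_return_words by (auto simp: sync_delay_iff)
  show "Suc d \<ge> 1"
    by simp
  fix u v w assume "v \<in> lpow ?R (Suc d)" and in_lstar: "u @ v @ w \<in> lstar ?R"
  then have "v \<in> lpow ?R d @@ ?R"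
    using lpow_add[of ?R d 1] by simp
  then obtain z k l where v: "v = z @ k @ l" "z \<in> lpow ?R d" "k \<in> lstar K" "l \<in> L"
    by (metis concE)
  then obtain x y where z: "z = x @ y" "y \<in> lpow ?P d"
    using lpow_lstar_conc_subset by (metis concE subsetD)
  have "u @ v @ w \<in> lstar ?P"
    using in_lstar subset_conc_left[of "lstar K" "lstar ?R"] by (auto simp: lstar_Un_denest)
  then have "(u @ x) @ y @ (k @ l @ w) \<in> lstar ?P"
    by (simp add: v z)
  then have "(u @ x) @ y \<in> lstar ?P"
    using assms(1) z(2) unfolding sync_delay_iff by blast
  then obtain r k' where ux: "r \<in> lstar ?R" "k' \<in> lstar K" "u @ x @ y = r @ k'"
    unfolding lstar_Un_denest by (metis append_assoc concE)
  have "(k' @ k) @ l \<in> ?R"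
    using ux v lstar_append by blast
  then have "r @ (k' @ k) @ l \<in> lstar ?R"
    using ux(1) by (meson lstar_append subset_lstar subsetD)
  moreover have "u @ v = r @ (k' @ k) @ l"
    using ux(3) z(1) v(1) by simp
  ultimately show "u @ v \<in> lstar ?R"
    by simp
qed

lemma bounded_sync_delay_return_words:
  "bounded_sync_delay (K \<union> L) \<Longrightarrow> K \<inter> L = {} \<Longrightarrow> bounded_sync_delay (lstar K @@ L)"
  unfolding bounded_sync_delay_iff using sync_delay_return_words by blast


section \<open>From bounded synchronization delay to the star-free closure\<close>

lemma maximal_lstar_prefix:
  assumes "[] \<notin> K"
  shows "\<exists>x z. w = x @ z \<and> x \<in> lstar K \<and> z \<notin> K @@ UNIV"
proof (induction "length w" arbitrary: w rule: less_induct)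
  case less
  show ?case
  proof (cases "w \<in> K @@ UNIV")
    case True
    then obtain k v where w: "k \<in> K" "w = k @ v"
      by blast
    then have "length v < length w"
      using assms by auto
    then obtain x z where "v = x @ z" "x \<in> lstar K" "z \<notin> K @@ UNIV"
      using less by blast
    moreover from this have "k @ x \<in> lstar K"
      using w(1) subset_lstar lstar_append by blast
    ultimately show ?thesis
      using w(2) by (metis append_assoc)
  qed (metis append_Nil Nil_in_lstar)
qed

lemma Compl_lstar_sync_delay:
  assumes "sync_delay K d"
  shows "- lstar K = ((\<Union>i<d. lpow K i) \<union> UNIV @@ lpow K d) @@ (- (K @@ UNIV) \<inter> - {[]})"
    (is "_ = ?X @@ ?Z")
proof -
  have code: "prefix_code K"
    using assms by (simp add: sync_delay_iff)
  show ?thesis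
  proof (intro equalityI subsetI)
    fix w assume outside: "w \<in> - lstar K"
    obtain x z where w: "w = x @ z" "x \<in> lstar K" "z \<notin> K @@ UNIV"
      using maximal_lstar_prefix[OF prefix_code_Nil[OF code]] by blast
    moreover from this have "z \<noteq> []"
      using outside by auto
    moreover have "x \<in> ?X"
      using w(2) by (subst (asm) lstar_split_lpow[of K d]) blast
    ultimately show "w \<in> ?X @@ ?Z"
      by blast
  next
    fix w assume "w \<in> ?X @@ ?Z"
    then obtain x z where w: "w = x @ z" "x \<in> ?X" "z \<notin> K @@ UNIV" "z \<noteq> []"
      by blast
    show "w \<in> - lstar K"
    proof
      assume inside: "w \<in> lstar K"
      from w(2) have "x \<in> lstar K"
      proof
        assume "x \<in> UNIV @@ lpow K d"
        then show ?thesis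
          using assms inside w(1) unfolding sync_delay_iff by fastforce
      qed (use lpow_subset_lstar in blast)
      then have "z \<in> lstar K"
        using lstar_left_unitary[OF code] inside w(1) by blast
      then show False
        using w(3,4) by (subst (asm) lstar_unfold) blast
    qed
  qed
qed

lemma SF_Int: "K \<in> SF C \<Longrightarrow> L \<in> SF C \<Longrightarrow> K \<inter> L \<in> SF C"
  using SF_compl[OF SF_union[OF SF_compl SF_compl], of K C L] by simp

lemma SF_UN:
  assumes "{} \<in> SF C" "finite I" "\<And>i. i \<in> I \<Longrightarrow> F i \<in> SF C"
  shows "(\<Union>i\<in>I. F i) \<in> SF C"
  using assms(2,3) by (induction rule: finite_induct) (auto intro: SF_union assms(1))

lemma SF_eps:
  assumes "{} \<in> SF C"
  shows "{[]} \<in> SF C"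
proof -
  have "- (\<Union>a. {[a]} @@ - {}) \<in> SF C"
    by (intro SF_compl SF_UN SF_conc SF_letter assms) auto
  moreover have "- (\<Union>a::'a. {[a]} @@ - {}) = {[]}"
    by (auto simp: conc_def) (metis list.exhaust)
  ultimately show ?thesis
    by simp
qed

lemma SF_lstar:
  assumes "{} \<in> SF C" "K \<in> SF C" "sync_delay K d"
  shows "lstar K \<in> SF C"
proof -
  have UNIV_in_SF: "UNIV \<in> SF C"
    using SF_compl[OF assms(1)] by simp
  have lpow_in_SF: "lpow K n \<in> SF C" for n
    by (induction n) (auto intro: SF_conc SF_eps assms)
  have "- lstar K \<in> SF C"
    unfolding Compl_lstar_sync_delay[OF assms(3)]
    by (intro SF_conc SF_union SF_UN SF_Int SF_compl SF_eps lpow_in_SF UNIV_in_SF assms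
        finite_lessThan)
  then show ?thesis
    using SF_compl by fastforce
qed

lemma SD_subset_SF:
  assumes "prevariety C"
  shows "SD C \<subseteq> SF C"
proof
  have empty_in_SF: "{} \<in> SF C"
    using assms by (auto simp: prevariety_def intro: SF_base)
  show "L \<in> SF C" if "L \<in> SD C" for L
    using that
  proof induction
    case (SD_star K)
    then show ?case
      using SF_lstar[OF empty_in_SF] by (auto simp: bounded_sync_delay_iff)
  qed (auto intro: SF.intros SF_Int empty_in_SF)
qed


section \<open>Left quotients\<close>

lemma lquot_Nil [simp]: "lquot [] L = L"
  by (simp add: lquot_def)

lemma lquot_append: "lquot (u @ v) L = lquot v (lquot u L)"
  by (simp add: lquot_def)

lemma lquot_Un: "lquot u (K \<union> L) = lquot u K \<union> lquot u L"
  by (auto simp: lquot_def)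

lemma lquot_Union: "lquot u (\<Union>\<X>) = \<Union>(lquot u ` \<X>)"
  by (auto simp: lquot_def)

lemma lquot_Compl: "lquot u (- L) = - lquot u L"
  by (auto simp: lquot_def)

lemma lquot_letter_conc:
  "lquot [a] (K @@ L) = lquot [a] K @@ L \<union> (if [] \<in> K then lquot [a] L else {})"
  unfolding lquot_def conc_def by (auto simp: Cons_eq_append_conv)

lemma lquot_letter_lstar: "lquot [a] (lstar K) = lquot [a] K @@ lstar K"
proof (intro equalityI subsetI)
  have "v \<in> lquot [a] K @@ lstar K" if "w \<in> lstar K" "w = a # v" for v w
    using that
  proof (induction rule: lstar_induct)
    case (append k x)
    then show ?case
      by (cases k) (auto simp: lquot_def)
  qed simp
  then show "v \<in> lquot [a] K @@ lstar K" if "v \<in> lquot [a] (lstar K)" for v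
    using that by (simp add: lquot_def)
next
  fix w assume "w \<in> lquot [a] K @@ lstar K"
  then obtain u v where "w = u @ v" "a # u \<in> K" "v \<in> lstar K"
    by (auto simp: lquot_def)
  then show "w \<in> lquot [a] (lstar K)"
    using lstar_append[of "a # u" K v] subset_lstar by (auto simp: lquot_def)
qed

definition lquots :: "'a list set \<Rightarrow> 'a list set set" where
  "lquots L = range (\<lambda>u. lquot u L)"

lemma self_in_lquots: "L \<in> lquots L"
  unfolding lquots_def by (metis lquot_Nil rangeI)

lemma lquot_in_lquots: "X \<in> lquots L \<Longrightarrow> lquot u X \<in> lquots L"
  by (auto simp: lquots_def simp flip: lquot_append)

lemma finite_lquotsI:
  assumes "finite \<F>" "L \<in> \<F>" "\<And>X a. X \<in> \<F> \<Longrightarrow> lquot [a] X \<in> \<F>"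
  shows "finite (lquots L)"
proof -
  have "lquot u X \<in> \<F>" if "X \<in> \<F>" for u X
    using that
  proof (induction u arbitrary: X)
    case (Cons a u)
    then show ?case
      using assms(3) lquot_append[of "[a]" u] by simp
  qed simp
  then show ?thesis
    using assms(1,2) by (auto simp: lquots_def intro: finite_subset[of _ \<F>])
qed

lemma finite_lquots_empty: "finite (lquots {})"
  by (rule finite_lquotsI[of "{{}}"]) (auto simp: lquot_def)

lemma finite_lquots_eps: "finite (lquots {[]})"
  by (rule finite_lquotsI[of "{{}, {[]}}"]) (auto simp: lquot_def)

lemma finite_lquots_letter: "finite (lquots {[a]})"
  by (rule finite_lquotsI[of "{{}, {[]}, {[a]}}"]) (auto simp: lquot_def)

lemma finite_lquots_Compl:
  assumes "finite (lquots L)"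
  shows "finite (lquots (- L))"
proof -
  have "lquots (- L) = uminus ` lquots L"
    by (simp add: lquots_def lquot_Compl image_image)
  then show ?thesis
    using assms by simp
qed

lemma finite_lquots_Un:
  assumes "finite (lquots K)" "finite (lquots L)"
  shows "finite (lquots (K \<union> L))"
proof (rule finite_lquotsI)
  let ?F = "(\<lambda>(X, Y). X \<union> Y) ` (lquots K \<times> lquots L)"
  show "finite ?F" "K \<union> L \<in> ?F"
    using assms self_in_lquots by auto
  fix Z a assume "Z \<in> ?F"
  then obtain X Y where "Z = X \<union> Y" "X \<in> lquots K" "Y \<in> lquots L"
    by auto
  then show "lquot [a] Z \<in> ?F"
    by (intro image_eqI[of _ _ "(lquot [a] X, lquot [a] Y)"]) (auto simp: lquot_Un lquot_in_lquots)
qed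

lemma finite_lquots_conc:
  assumes "finite (lquots K)" "finite (lquots L)"
  shows "finite (lquots (K @@ L))"
proof (rule finite_lquotsI)
  let ?F = "(\<lambda>(X, \<Y>). X @@ L \<union> \<Union>\<Y>) ` (lquots K \<times> Pow (lquots L))"
  show "finite ?F"
    using assms by simp
  show "K @@ L \<in> ?F"
    using self_in_lquots by (intro image_eqI[of _ _ "(K, {})"]) auto
  fix Z a assume "Z \<in> ?F"
  then obtain X \<Y> where "Z = X @@ L \<union> \<Union>\<Y>" "X \<in> lquots K" "\<Y> \<subseteq> lquots L"
    by auto
  then show "lquot [a] Z \<in> ?F"
    by (intro image_eqI[of _ _
          "(lquot [a] X, (if [] \<in> X then {lquot [a] L} else {}) \<union> lquot [a] ` \<Y>)"])
      (auto simp: lquot_Un lquot_Union lquot_letter_conc self_in_lquots lquot_in_lquots)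
qed

lemma finite_lquots_lstar:
  assumes "finite (lquots K)"
  shows "finite (lquots (lstar K))"
proof (rule finite_lquotsI)
  let ?F = "insert (lstar K) ((\<lambda>\<Y>. \<Union>\<Y> @@ lstar K) ` Pow (lquots K))"
  show "finite ?F" "lstar K \<in> ?F"
    using assms by simp_all
  fix Z a assume "Z \<in> ?F"
  then consider (star) "Z = lstar K" | (conc) \<Y> where "Z = \<Union>\<Y> @@ lstar K" "\<Y> \<subseteq> lquots K"
    by auto
  then show "lquot [a] Z \<in> ?F"
  proof cases
    case star
    have "lquot [a] Z = \<Union>{lquot [a] K} @@ lstar K"
      by (simp add: star lquot_letter_lstar)
    then show ?thesis
      using lquot_in_lquots[OF self_in_lquots] by blast
  next
    case conc
    let ?Z = "if [] \<in> \<Union>\<Y> then {lquot [a] K} else {}"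
    have "\<Union>?Z @@ lstar K = (if [] \<in> \<Union>\<Y> then lquot [a] K @@ lstar K else {})"
      by simp
    then have "lquot [a] Z = \<Union>(lquot [a] ` \<Y> \<union> ?Z) @@ lstar K"
      by (simp only: conc(1) lquot_letter_conc lquot_letter_lstar lquot_Union Union_Un_distrib
          conc_Un_left)
    moreover have "lquot [a] ` \<Y> \<union> ?Z \<subseteq> lquots K"
      using conc(2) by (auto simp: self_in_lquots lquot_in_lquots)
    ultimately show ?thesis
      by blast
  qed
qed

lemma finite_lquots_regular: "regular L \<Longrightarrow> finite (lquots L)"
  by (induction rule: regular.induct)
    (auto intro: finite_lquots_empty finite_lquots_eps finite_lquots_letter
      finite_lquots_Un finite_lquots_conc finite_lquots_lstar)

lemma finite_rquots:
  assumes "finite (lquots L)"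
  shows "finite (range (rquot L))"
proof -
  have "rquot L y = {v. lquot v L \<in> {X \<in> lquots L. y \<in> X}}" for y
    by (auto simp: rquot_def lquots_def lquot_def)
  then have "range (rquot L) \<subseteq> (\<lambda>\<X>. {v. lquot v L \<in> \<X>}) ` Pow (lquots L)"
    by blast
  then show ?thesis
    by (rule finite_subset) (use assms in simp)
qed

lemma prevariety_UN:
  assumes "prevariety C" "finite I" "\<And>i. i \<in> I \<Longrightarrow> F i \<in> C"
  shows "(\<Union>i\<in>I. F i) \<in> C"
  using assms(2,3) by (induction rule: finite_induct) (use assms(1) in \<open>auto simp: prevariety_def\<close>)

lemma prevariety_INT:
  assumes "prevariety C" "finite I" "\<And>i. i \<in> I \<Longrightarrow> F i \<in> C"
  shows "(\<Inter>i\<in>I. F i) \<in> C"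
  using assms(2,3) by (induction rule: finite_induct) (use assms(1) in \<open>auto simp: prevariety_def\<close>)

lemma prevariety_finite_lquots: "prevariety C \<Longrightarrow> L \<in> C \<Longrightarrow> finite (lquots L)"
  by (simp add: prevariety_def finite_lquots_regular)

lemma prevariety_lquot_eq:
  assumes "prevariety C" "L \<in> C"
  shows "{v. lquot v L = X} \<in> C"
proof -
  have "finite (range (rquot L))"
    by (intro finite_rquots prevariety_finite_lquots[OF assms])
  then have finite_rquot_image: "finite (rquot L ` Y)" for Y
    by (rule finite_subset[rotated]) blast
  have "(\<Inter>M\<in>rquot L ` X. M) \<in> C" "(\<Inter>M\<in>rquot L ` (- X). - M) \<in> C"
    by (rule prevariety_INT[OF assms(1) finite_rquot_image];
        use assms in \<open>auto simp: prevariety_def\<close>)+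
  then have "(\<Inter>M\<in>rquot L ` X. M) \<inter> (\<Inter>M\<in>rquot L ` (- X). - M) \<in> C"
    using assms(1) by (simp add: prevariety_def)
  moreover have "(\<Inter>M\<in>rquot L ` X. M) \<inter> (\<Inter>M\<in>rquot L ` (- X). - M) = {v. lquot v L = X}"
    by (auto simp: rquot_def lquot_def)
  ultimately show ?thesis
    by simp
qed


section \<open>The action of words on sets of languages\<close>

definition maps_into :: "'a list set \<Rightarrow> 'a list set set \<Rightarrow> 'a list set set \<Rightarrow> bool" where
  "maps_into K S S' \<longleftrightarrow> (\<forall>w\<in>K. lquot w \<in> S \<rightarrow> S')"

lemma maps_intoD: "maps_into K S S' \<Longrightarrow> w \<in> K \<Longrightarrow> X \<in> S \<Longrightarrow> lquot w X \<in> S'"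
  by (auto simp: maps_into_def)

lemma maps_into_mono: "maps_into K S S' \<Longrightarrow> K' \<subseteq> K \<Longrightarrow> R \<subseteq> S \<Longrightarrow> S' \<subseteq> R' \<Longrightarrow> maps_into K' R R'"
  by (fastforce simp: maps_into_def)

lemma maps_into_conc: "maps_into K S S' \<Longrightarrow> maps_into L S' S'' \<Longrightarrow> maps_into (K @@ L) S S''"
  by (fastforce simp: maps_into_def lquot_append)

lemma maps_into_lstar:
  assumes "maps_into K S S"
  shows "maps_into (lstar K) S S"
proof -
  have "lquot w \<in> S \<rightarrow> S" if "w \<in> lstar K" for w
    using that
    by (induction rule: lstar_induct) (use assms in \<open>auto simp: maps_into_def lquot_append\<close>)
  then show ?thesis
    by (simp add: maps_into_def)
qed

lemma maps_into_lquots: "maps_into K (lquots L) (lquots L)"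
  by (simp add: maps_into_def lquot_in_lquots)

definition action :: "'a list set set \<Rightarrow> 'a list \<Rightarrow> 'a list set \<Rightarrow> 'a list set" where
  "action S w = restrict (lquot w) S"

lemma action_apply [simp]: "X \<in> S \<Longrightarrow> action S w X = lquot w X"
  by (simp add: action_def)

lemma action_eq_iff: "action S u = action S v \<longleftrightarrow> (\<forall>X\<in>S. lquot u X = lquot v X)"
  by (auto simp: action_def fun_eq_iff)

lemma action_append:
  "maps_into K S S' \<Longrightarrow> u \<in> K \<Longrightarrow> action S (u @ v) = compose S (action S' v) (action S u)"
  by (auto simp: action_def compose_def lquot_append fun_eq_iff dest: maps_intoD)

lemma finite_action:
  assumes "finite S" "maps_into K S S"
  shows "finite (action S ` K)"
proof -
  have "action S ` K \<subseteq> S \<rightarrow>\<^sub>E S"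
    using assms(2) by (simp add: maps_into_def action_def image_subset_iff)
  then show ?thesis
    by (rule finite_subset) (use assms(1) in \<open>simp add: finite_PiE\<close>)
qed

lemma action_append_cong:
  assumes "maps_into UNIV T T" "action T u = action T u'" "action T v = action T v'"
  shows "action T (u @ v) = action T (u' @ v')"
  using action_append[OF assms(1) UNIV_I] assms(2,3) by metis

abbreviation word_power :: "'a list \<Rightarrow> nat \<Rightarrow> 'a list" (infixr "\<up>" 80) where
  "w \<up> n \<equiv> concat (replicate n w)"

lemma word_power_add: "w \<up> (m + n) = w \<up> m @ w \<up> n"
  by (simp add: replicate_add)

lemma word_power_in_lstar: "w \<in> lstar K \<Longrightarrow> w \<up> n \<in> lstar K"
  by (induction n) (auto intro: lstar_append)

lemma ex_idempotent_index:
  fixes f :: "nat \<Rightarrow> 'b"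
  assumes "finite (range f)" and shift: "\<And>i j k. f i = f j \<Longrightarrow> f (i + k) = f (j + k)"
  shows "\<exists>m>0. f (m + m) = f m"
proof -
  have "\<not> inj f"
    using assms(1) finite_imageD infinite_UNIV_nat by blast
  then obtain i p where "p > 0" and repeat: "f (i + p) = f i"
    unfolding inj_def by (metis less_imp_add_positive linorder_neqE_nat)
  have period: "f (i + k + n * p) = f (i + k)" for k n
  proof (induction n)
    case (Suc n)
    have "f (i + k + Suc n * p) = f (i + p + (k + n * p))"
      by (simp add: ac_simps)
    also have "\<dots> = f (i + (k + n * p))"
      by (rule shift[OF repeat])
    finally show ?case
      using Suc by (simp add: ac_simps)
  qed simp
  have "i \<le> Suc i * p"
    using \<open>p > 0\<close> by (cases p) auto
  then have "f (Suc i * p + Suc i * p) = f (Suc i * p)"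
    using period[of "Suc i * p - i" "Suc i"] by simp
  then show ?thesis
    using \<open>p > 0\<close> by (intro exI[of _ "Suc i * p"]) simp
qed

lemma ex_idempotent_word_power:
  assumes "finite T" "maps_into UNIV T T"
  shows "\<exists>m>0. action T (u \<up> m @ u \<up> m) = action T (u \<up> m)"
proof -
  have "finite (range (\<lambda>i. action T (u \<up> i)))"
    using finite_action[OF assms] by (rule finite_subset[rotated]) blast
  then have "\<exists>m>0. action T (u \<up> (m + m)) = action T (u \<up> m)"
    by (rule ex_idempotent_index) (auto simp: word_power_add intro: action_append_cong[OF assms(2)])
  then show ?thesis
    by (simp add: word_power_add)
qed


section \<open>Relative aperiodicity\<close>

definition pumps :: "'a list \<Rightarrow> 'a list set \<Rightarrow> bool" where
  "pumps w L \<longleftrightarrow> (\<exists>n. \<forall>x y. x @ w \<up> n @ y \<in> L \<longleftrightarrow> x @ w \<up> Suc n @ y \<in> L)"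

lemma pumps_iff:
  "pumps w L \<longleftrightarrow> (\<exists>n. \<forall>i\<ge>n. \<forall>j\<ge>n. \<forall>x y. x @ w \<up> i @ y \<in> L \<longleftrightarrow> x @ w \<up> j @ y \<in> L)"
proof
  assume "pumps w L"
  then obtain n where pump: "x @ w \<up> n @ y \<in> L \<longleftrightarrow> x @ w \<up> Suc n @ y \<in> L" for x y
    unfolding pumps_def by blast
  have "x @ w \<up> (n + k) @ y \<in> L \<longleftrightarrow> x @ w \<up> n @ y \<in> L" for k x y
  proof (induction k)
    case (Suc k)
    have "w \<up> (n + Suc k) = w \<up> Suc n @ w \<up> k" "w \<up> (n + k) = w \<up> n @ w \<up> k"
      by (simp_all only: word_power_add flip: add_Suc_shift)
    then show ?case
      using pump[of x "w \<up> k @ y"] Suc by (simp del: replicate_Suc)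
  qed simp
  then have "x @ w \<up> i @ y \<in> L \<longleftrightarrow> x @ w \<up> n @ y \<in> L" if "i \<ge> n" for i x y
    using that le_iff_add by metis
  then show "\<exists>n. \<forall>i\<ge>n. \<forall>j\<ge>n. \<forall>x y. x @ w \<up> i @ y \<in> L \<longleftrightarrow> x @ w \<up> j @ y \<in> L"
    by blast
qed (unfold pumps_def, metis le_add2 order_refl plus_1_eq_Suc)

lemma pumps_common_exponent:
  assumes "pumps w K" "pumps w L"
  obtains n where "\<And>i j x y. i \<ge> n \<Longrightarrow> j \<ge> n \<Longrightarrow> x @ w \<up> i @ y \<in> K \<longleftrightarrow> x @ w \<up> j @ y \<in> K"
    and "\<And>i j x y. i \<ge> n \<Longrightarrow> j \<ge> n \<Longrightarrow> x @ w \<up> i @ y \<in> L \<longleftrightarrow> x @ w \<up> j @ y \<in> L"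
proof -
  obtain m where "\<forall>i\<ge>m. \<forall>j\<ge>m. \<forall>x y. x @ w \<up> i @ y \<in> K \<longleftrightarrow> x @ w \<up> j @ y \<in> K"
    using assms(1) unfolding pumps_iff by blast
  moreover obtain n where "\<forall>i\<ge>n. \<forall>j\<ge>n. \<forall>x y. x @ w \<up> i @ y \<in> L \<longleftrightarrow> x @ w \<up> j @ y \<in> L"
    using assms(2) unfolding pumps_iff by blast
  ultimately show thesis
    by (intro that[of "max m n"]) simp_all
qed

lemma pumps_letter: "pumps w {[a]}"
proof (cases "w = []")
  case False
  have "x @ w \<up> Suc (Suc n) @ y \<noteq> [a]" for x y n
  proof
    assume "x @ w \<up> Suc (Suc n) @ y = [a]"
    then have "length (x @ w \<up> Suc (Suc n) @ y) = 1"
      by simp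
    then show False
      using False by (cases w) auto
  qed
  then show ?thesis
    unfolding pumps_def by (metis singletonD)
qed (simp add: pumps_def)

lemma pumps_Compl: "pumps w L \<Longrightarrow> pumps w (- L)"
  by (simp add: pumps_def)

lemma pumps_Un:
  assumes "pumps w K" "pumps w L"
  shows "pumps w (K \<union> L)"
  using pumps_common_exponent[OF assms] unfolding pumps_iff by (metis Un_iff)

lemma conc_replace_infix:
  assumes mem: "x @ s @ t @ y \<in> K @@ L" and compatible: "s' @ t = s @ t'"
    and K_replace: "\<And>x y. x @ s @ y \<in> K \<Longrightarrow> x @ s' @ y \<in> K"
    and L_replace: "\<And>x y. x @ t @ y \<in> L \<Longrightarrow> x @ t' @ y \<in> L"
  shows "x @ s @ t' @ y \<in> K @@ L"
proof -
  obtain u v where uv: "u \<in> K" "v \<in> L" "x @ s @ t @ y = u @ v"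
    using mem by (rule concE)
  then have "(x @ s) @ (t @ y) = u @ v"
    by simp
  then consider (in_left) c where "u = x @ s @ c" "t @ y = c @ v"
    | (in_right) c where "x @ s = u @ c" "v = c @ t @ y"
    unfolding append_eq_append_conv2 by auto
  then show ?thesis
  proof cases
    case in_left
    then have "(x @ s' @ c) @ v \<in> K @@ L"
      using uv(1,2) K_replace by blast
    moreover have "(x @ s' @ c) @ v = x @ (s' @ t) @ y"
      by (simp add: in_left(2))
    ultimately show ?thesis
      by (simp add: compatible)
  next
    case in_right
    then have "u @ (c @ t' @ y) \<in> K @@ L"
      using uv(1,2) L_replace by blast
    moreover have "u @ (c @ t' @ y) = (x @ s) @ t' @ y"
      by (simp add: in_right(1))
    ultimately show ?thesis
      by simp
  qed
qed

lemma pumps_conc: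
  assumes "pumps w K" "pumps w L"
  shows "pumps w (K @@ L)"
proof -
  obtain n
    where K_pump: "\<And>i j x y. i \<ge> n \<Longrightarrow> j \<ge> n \<Longrightarrow> x @ w \<up> i @ y \<in> K \<longleftrightarrow> x @ w \<up> j @ y \<in> K"
      and L_pump: "\<And>i j x y. i \<ge> n \<Longrightarrow> j \<ge> n \<Longrightarrow> x @ w \<up> i @ y \<in> L \<longleftrightarrow> x @ w \<up> j @ y \<in> L"
    using pumps_common_exponent[OF assms] by blast
  have transfer: "x @ w \<up> (p + q') @ y \<in> K @@ L"
    if mem: "x @ w \<up> (p + q) @ y \<in> K @@ L" and sums: "p' + q = p + q'"
      and large: "p \<ge> n" "q \<ge> n" "p' \<ge> n" "q' \<ge> n" for x y p q p' q'
  proof -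
    have K_replace: "x @ w \<up> p @ y \<in> K \<Longrightarrow> x @ w \<up> p' @ y \<in> K"
      and L_replace: "x @ w \<up> q @ y \<in> L \<Longrightarrow> x @ w \<up> q' @ y \<in> L" for x y
      using K_pump[of p p' x y] L_pump[of q q' x y] large by simp_all
    have "x @ w \<up> p @ w \<up> q @ y \<in> K @@ L"
      using mem by (simp add: word_power_add)
    moreover have "w \<up> p' @ w \<up> q = w \<up> p @ w \<up> q'"
      using sums by (metis word_power_add)
    ultimately have "x @ w \<up> p @ w \<up> q' @ y \<in> K @@ L"
      using K_replace L_replace by (rule conc_replace_infix)
    then show ?thesis
      by (simp add: word_power_add)
  qed
  show ?thesis
    unfolding pumps_def
  proof (intro exI allI iffI)
    show "x @ w \<up> Suc (2 * n + 1) @ y \<in> K @@ L" if "x @ w \<up> (2 * n + 1) @ y \<in> K @@ L" for x y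
      using transfer[of x "n + 1" n y "n + 2" "n + 1"] that
      by (simp add: mult_2 del: replicate_Suc)
    show "x @ w \<up> (2 * n + 1) @ y \<in> K @@ L" if "x @ w \<up> Suc (2 * n + 1) @ y \<in> K @@ L" for x y
      using transfer[of x "n + 1" "n + 1" y n n] that
      by (simp add: mult_2 del: replicate_Suc)
  qed
qed

locale relatively_aperiodic =
  fixes C :: "'a::finite list set set" and T :: "'a list set set" and L :: "'a list set"
  assumes prevariety: "prevariety C"
    and finite_T: "finite T" and T_subset: "T \<subseteq> C" and T_invariant: "maps_into UNIV T T"
    and idempotent_pumps: "action T (w @ w) = action T w \<Longrightarrow> pumps w L"
begin

lemma saturated_in_prevariety:
  assumes saturated: "\<And>u v. action T u = action T v \<Longrightarrow> u \<in> W \<Longrightarrow> v \<in> W"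
  shows "W \<in> C"
proof -
  have "finite (action T ` W)"
    using finite_action[OF finite_T T_invariant] by (rule finite_subset[rotated]) blast
  then have "(\<Union>g\<in>action T ` W. \<Inter>X\<in>T. {v. lquot v X = g X}) \<in> C"
    using T_subset
    by (intro prevariety_UN prevariety_INT prevariety_lquot_eq prevariety finite_T) auto
  moreover have "(\<Inter>X\<in>T. {v. lquot v X = action T u X}) = {v. action T v = action T u}" for u
    by (intro set_eqI) (simp add: action_eq_iff cong: ball_cong)
  ultimately have "(\<Union>u\<in>W. {v. action T v = action T u}) \<in> C"
    by simp
  also have "(\<Union>u\<in>W. {v. action T v = action T u}) = W"
    using saturated[OF sym] by blast
  finally show ?thesis .
qed

lemma relatively_aperiodic_superset:
  assumes "finite T'" "T' \<subseteq> C" "maps_into UNIV T' T'" "T \<subseteq> T'"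
  shows "relatively_aperiodic C T' L"
proof
  show "pumps w L" if "action T' (w @ w) = action T' w" for w
    using that assms(4) by (intro idempotent_pumps) (auto simp: action_eq_iff)
qed (use prevariety assms in auto)

end

lemma relatively_aperiodic_common:
  assumes "relatively_aperiodic C T K" "relatively_aperiodic C U L"
  shows "relatively_aperiodic C (T \<union> U) K" "relatively_aperiodic C (T \<union> U) L"
proof -
  interpret left: relatively_aperiodic C T K by fact
  interpret right: relatively_aperiodic C U L by fact
  have "finite (T \<union> U)" "T \<union> U \<subseteq> C" "maps_into UNIV (T \<union> U) (T \<union> U)"
    using left.finite_T left.T_subset left.T_invariant
      right.finite_T right.T_subset right.T_invariant
    by (auto simp: maps_into_def)
  then show "relatively_aperiodic C (T \<union> U) K" "relatively_aperiodic C (T \<union> U) L"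
    by (simp_all add: left.relatively_aperiodic_superset right.relatively_aperiodic_superset)
qed

lemma relatively_aperiodic_base:
  assumes "prevariety C" "L \<in> C"
  shows "relatively_aperiodic C (lquots L) L"
proof
  show "finite (lquots L)"
    by (rule prevariety_finite_lquots[OF assms])
  show "lquots L \<subseteq> C"
    using assms by (auto simp: prevariety_def lquots_def)
  fix w assume idem: "action (lquots L) (w @ w) = action (lquots L) w"
  have "x @ w \<up> 1 @ y \<in> L \<longleftrightarrow> x @ w \<up> Suc 1 @ y \<in> L" for x y
  proof -
    have "lquot (w @ w) (lquot x L) = lquot w (lquot x L)"
      using idem unfolding action_eq_iff by (simp add: lquots_def)
    then show ?thesis
      by (auto simp: lquot_def)
  qed
  then show "pumps w L"
    unfolding pumps_def by blast
qed (simp_all add: assms maps_into_lquots)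

lemma SF_relatively_aperiodic:
  assumes "prevariety C" "L \<in> SF C"
  shows "\<exists>T. relatively_aperiodic C T L"
  using assms(2)
proof induction
  case (SF_base L)
  then show ?case
    using relatively_aperiodic_base[OF assms(1)] by blast
next
  case (SF_letter a)
  have "relatively_aperiodic C {} {[a]}"
    by unfold_locales (simp_all add: assms(1) maps_into_def pumps_letter)
  then show ?case ..
next
  case (SF_union K L)
  then obtain T where "relatively_aperiodic C T K" "relatively_aperiodic C T L"
    by (metis relatively_aperiodic_common)
  then have "relatively_aperiodic C T (K \<union> L)"
    by (simp add: relatively_aperiodic_def pumps_Un)
  then show ?case ..
next
  case (SF_compl K)
  then show ?case
    unfolding relatively_aperiodic_def by (meson pumps_Compl)
next
  case (SF_conc K L)
  then obtain T where "relatively_aperiodic C T K" "relatively_aperiodic C T L"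
    by (metis relatively_aperiodic_common)
  then have "relatively_aperiodic C T (K @@ L)"
    by (simp add: relatively_aperiodic_def pumps_conc)
  then show ?case ..
qed

lemma SF_finite_lquots:
  assumes "\<And>X. X \<in> C \<Longrightarrow> finite (lquots X)" "L \<in> SF C"
  shows "finite (lquots L)"
  using assms(2)
  by induction (auto intro: assms(1) finite_lquots_letter finite_lquots_Un finite_lquots_Compl
      finite_lquots_conc)


section \<open>Words acting as permutations\<close>

lemma bij_betw_lquot_lstar:
  assumes "\<forall>w\<in>P. bij_betw (lquot w) S S" "w \<in> lstar P"
  shows "bij_betw (lquot w) S S"
  using assms(2)
proof (induction rule: lstar_induct)
  case Nil
  show ?case
    by (simp add: bij_betw_def inj_on_def)
next
  case (append k x)
  have "lquot (k @ x) = lquot x \<circ> lquot k"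
    by (simp add: fun_eq_iff lquot_append)
  then show ?case
    using bij_betw_trans[OF assms(1)[rule_format, OF append.hyps(1)] append.IH] by (simp only:)
qed

context relatively_aperiodic
begin

lemma idempotent_permutation_trivial:
  assumes "action T (w @ w) = action T w" "S \<subseteq> lquots L" "bij_betw (lquot w) S S" "X \<in> S"
  shows "lquot w X = X"
proof -
  obtain n where pump: "\<And>x y. x @ w \<up> n @ y \<in> L \<longleftrightarrow> x @ w \<up> Suc n @ y \<in> L"
    using idempotent_pumps[OF assms(1)] unfolding pumps_def by blast
  obtain x where "X = lquot x L"
    using assms(2,4) by (auto simp: lquots_def)
  then have "lquot (w \<up> n) (lquot w X) = lquot (w \<up> n) X"
    using pump[of x] by (auto simp: lquot_def)
  moreover have "bij_betw (lquot (w \<up> n)) S S"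
    by (rule bij_betw_lquot_lstar[of "{w}", OF _ word_power_in_lstar])
      (use assms(3) subset_lstar[of "{w}"] in auto)
  moreover have "lquot w X \<in> S"
    using assms(3,4) by (rule bij_betw_apply)
  ultimately show ?thesis
    using assms(4) by (auto simp: bij_betw_def dest: inj_onD)
qed

lemma permutations_determined:
  assumes "S \<subseteq> lquots L" and bij: "\<forall>w\<in>P. bij_betw (lquot w) S S"
    and words: "u \<in> lstar P" "v \<in> lstar P" and same_T: "action T u = action T v"
  shows "action S u = action S v"
proof -
  obtain m where "m > 0" and u_idem: "action T (u \<up> m @ u \<up> m) = action T (u \<up> m)"
    using ex_idempotent_word_power[OF finite_T T_invariant] by blast
  define z where "z = u \<up> (m - 1)"
  have power: "u \<up> m = u @ z"
    using \<open>m > 0\<close> by (cases m) (simp_all add: z_def)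
  have same_T': "action T (v @ z) = action T (u @ z)"
    using same_T by (intro action_append_cong[OF T_invariant]) simp_all
  have "action T ((v @ z) @ v @ z) = action T ((u @ z) @ u @ z)"
    using same_T' same_T' by (rule action_append_cong[OF T_invariant])
  then have v_idem: "action T ((v @ z) @ v @ z) = action T (v @ z)"
    using u_idem same_T' by (simp add: power)
  have in_lstar: "z \<in> lstar P" "u @ z \<in> lstar P" "v @ z \<in> lstar P"
    unfolding z_def by (intro lstar_append word_power_in_lstar words)+
  note bij_lstar = bij_betw_lquot_lstar[OF bij]
  have "lquot u X = lquot v X" if "X \<in> S" for X
  proof (rule inj_onD)
    show "inj_on (lquot z) S"
      using bij_lstar[OF in_lstar(1)] by (simp add: bij_betw_def)
    show "lquot u X \<in> S" "lquot v X \<in> S"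
      using bij_betw_apply[OF bij_lstar] words that by blast+
    have "lquot (u @ z) X = X" "lquot (v @ z) X = X"
      using idempotent_permutation_trivial[OF _ assms(1) bij_lstar that] in_lstar u_idem v_idem
      by (simp_all add: power)
    then show "lquot z (lquot u X) = lquot z (lquot v X)"
      by (simp add: lquot_append)
  qed
  then show ?thesis
    by (simp add: action_eq_iff)
qed

end


section \<open>Languages with fibres in \<open>SD\<close>\<close>

lemma SD_UN:
  assumes "finite I" "\<And>i. i \<in> I \<Longrightarrow> F i \<in> SD C" "disjoint_family_on F I"
  shows "(\<Union>i\<in>I. F i) \<in> SD C"
  using assms
proof (induction rule: finite_induct)
  case (insert i I)
  then show ?case
    by (auto simp: disjoint_family_on_insert intro!: SD_union)
qed (simp add: SD_empty)

lemma SD_lstar: "K \<in> SD C \<Longrightarrow> bounded_sync_delay K \<Longrightarrow> lstar K \<in> SD C"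
  by (intro SD_star bounded_sync_delay_prefix_code)

lemma SD_eps: "{[]} \<in> SD C"
proof -
  have "lstar {} \<in> SD C"
    using sync_delay_empty by (intro SD_lstar SD_empty) (auto simp: bounded_sync_delay_iff)
  then show ?thesis
    by simp
qed

definition SD_fibres :: "'a::finite list set set \<Rightarrow> ('a list \<Rightarrow> 'b) \<Rightarrow> 'a list set \<Rightarrow> bool" where
  "SD_fibres C \<tau> K \<longleftrightarrow> finite (\<tau> ` K) \<and> (\<forall>g. {w \<in> K. \<tau> w = g} \<in> SD C)"

lemma SD_fibres_finite: "SD_fibres C \<tau> K \<Longrightarrow> finite (\<tau> ` K)"
  by (simp add: SD_fibres_def)

lemma SD_fibres_Collect:
  assumes "SD_fibres C \<tau> K"
  shows "{w \<in> K. Q (\<tau> w)} \<in> SD C"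
proof -
  have "(\<Union>g\<in>{g \<in> \<tau> ` K. Q g}. {w \<in> K. \<tau> w = g}) \<in> SD C"
    using assms by (intro SD_UN) (auto simp: SD_fibres_def disjoint_family_on_def)
  moreover have "(\<Union>g\<in>{g \<in> \<tau> ` K. Q g}. {w \<in> K. \<tau> w = g}) = {w \<in> K. Q (\<tau> w)}"
    by auto
  ultimately show ?thesis
    by simp
qed

lemma SD_fibres_in_SD: "SD_fibres C \<tau> K \<Longrightarrow> K \<in> SD C"
  using SD_fibres_Collect[of C \<tau> K "\<lambda>_. True"] by simp

lemma SD_fibres_restrict:
  assumes "SD_fibres C \<tau> K"
  shows "SD_fibres C \<tau> {w \<in> K. Q (\<tau> w)}"
  unfolding SD_fibres_def
proof (intro conjI allI)
  show "finite (\<tau> ` {w \<in> K. Q (\<tau> w)})"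
    by (rule finite_subset[OF _ SD_fibres_finite[OF assms]]) blast
  show "{w \<in> {w \<in> K. Q (\<tau> w)}. \<tau> w = g} \<in> SD C" for g
    using SD_fibres_Collect[OF assms, of "\<lambda>t. Q t \<and> t = g"] by (simp add: conj_assoc)
qed

lemma SD_fibres_coarsen:
  assumes "SD_fibres C \<tau> K" "\<And>w. w \<in> K \<Longrightarrow> \<sigma> w = f (\<tau> w)"
  shows "SD_fibres C \<sigma> K"
  unfolding SD_fibres_def
proof (intro conjI allI)
  have "\<sigma> ` K = f ` \<tau> ` K"
    using assms(2) by (auto simp: image_iff)
  then show "finite (\<sigma> ` K)"
    by (simp add: SD_fibres_finite[OF assms(1)])
  have "{w \<in> K. \<sigma> w = g} = {w \<in> K. f (\<tau> w) = g}" for g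
    using assms(2) by auto
  then show "{w \<in> K. \<sigma> w = g} \<in> SD C" for g
    using SD_fibres_Collect[OF assms(1), of "\<lambda>t. f t = g"] by simp
qed

lemma SD_fibres_Un:
  assumes "SD_fibres C \<tau> K" "SD_fibres C \<tau> L" "K \<inter> L = {}"
  shows "SD_fibres C \<tau> (K \<union> L)"
  unfolding SD_fibres_def
proof (intro conjI allI)
  show "finite (\<tau> ` (K \<union> L))"
    using assms by (simp add: SD_fibres_finite image_Un)
  have "{w \<in> K \<union> L. \<tau> w = g} = {w \<in> K. \<tau> w = g} \<union> {w \<in> L. \<tau> w = g}" for g
    by auto
  then show "{w \<in> K \<union> L. \<tau> w = g} \<in> SD C" for g
    using assms by (auto simp: SD_fibres_def intro!: SD_union)
qed

lemma SD_fibres_singleton: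
  assumes "{w} \<in> SD C"
  shows "SD_fibres C \<tau> {w}"
  using assms by (simp add: SD_fibres_def Collect_conv_if SD_empty)

lemma SD_fibres_letters: "SD_fibres C \<tau> (range (\<lambda>a. [a]))"
proof -
  have "SD_fibres C \<tau> ((\<lambda>a. [a]) ` B)" if "finite B" for B
    using that
  proof (induction rule: finite_induct)
    case empty
    show ?case
      by (simp add: SD_fibres_def SD_empty)
  next
    case (insert a B)
    then have "SD_fibres C \<tau> ({[a]} \<union> (\<lambda>a. [a]) ` B)"
      by (intro SD_fibres_Un SD_fibres_singleton SD_letter) auto
    then show ?case
      by simp
  qed
  then show ?thesis
    by simp
qed

lemma SD_fibres_conc:
  assumes left: "SD_fibres C \<tau> K" and right: "SD_fibres C \<rho> L" and unambiguous: "unambiguous K L"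
    and factors: "\<And>u v. u \<in> K \<Longrightarrow> v \<in> L \<Longrightarrow> \<sigma> (u @ v) = f (\<tau> u) (\<rho> v)"
  shows "SD_fibres C \<sigma> (K @@ L)"
  unfolding SD_fibres_def
proof (intro conjI allI)
  have "\<sigma> ` (K @@ L) \<subseteq> (\<lambda>(s, t). f s t) ` (\<tau> ` K \<times> \<rho> ` L)"
    using factors by force
  then show "finite (\<sigma> ` (K @@ L))"
    by (rule finite_subset) (simp add: SD_fibres_finite[OF left] SD_fibres_finite[OF right])
  fix g
  let ?F = "\<lambda>s. {u \<in> K. \<tau> u = s} @@ {v \<in> L. f s (\<rho> v) = g}"
  have "(\<Union>s\<in>\<tau> ` K. ?F s) \<in> SD C"
  proof (rule SD_UN)
    show "finite (\<tau> ` K)"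
      by (rule SD_fibres_finite[OF left])
    show "?F s \<in> SD C" for s
      using left SD_fibres_Collect[OF right] unambiguous_subset[OF unambiguous]
      by (intro SD_conc) (auto simp: SD_fibres_def)
    show "disjoint_family_on ?F (\<tau> ` K)"
      unfolding disjoint_family_on_def
      by (intro ballI impI unambiguous_conc_disjoint[OF unambiguous]) auto
  qed
  moreover have "(\<Union>s\<in>\<tau> ` K. ?F s) = {w \<in> K @@ L. \<sigma> w = g}"
    using factors by (fastforce simp: conc_def)
  ultimately show "{w \<in> K @@ L. \<sigma> w = g} \<in> SD C"
    by simp
qed

lemma SD_fibres_action_conc:
  assumes "SD_fibres C (action S) K" "SD_fibres C (action S') L" "unambiguous K L"
    and "maps_into K S S'"
  shows "SD_fibres C (action S) (K @@ L)"
  using action_append[OF assms(4)] by (rule SD_fibres_conc[OF assms(1-3)])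

lemma SD_fibres_action_subset:
  assumes "SD_fibres C (action S) K" "S' \<subseteq> S"
  shows "SD_fibres C (action S') K"
proof (rule SD_fibres_coarsen[OF assms(1)])
  show "action S' w = restrict (action S w) S'" for w
    using assms(2) by (auto simp: action_def fun_eq_iff)
qed

lemma SD_fibres_lstar_shrinking:
  assumes "prefix_code R" and maps: "maps_into R S S'" "S' \<subseteq> S"
    and "SD_fibres C (action S) R" "SD_fibres C (action S') (lstar R)"
  shows "SD_fibres C (action S) (lstar R)"
proof -
  have "SD_fibres C (action S) (R @@ lstar R)"
    using assms(4,5) prefix_code_unambiguous[OF assms(1)] maps(1) by (rule SD_fibres_action_conc)
  moreover have "{[]} \<inter> R @@ lstar R = {}"
    using prefix_code_Nil[OF assms(1)] by (auto simp: conc_def)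
  ultimately show ?thesis
    by (subst lstar_unfold) (intro SD_fibres_Un SD_fibres_singleton SD_eps)
qed

lemma SD_fibres_lstar_Un:
  assumes delay: "bounded_sync_delay (K \<union> L)" and disjoint: "K \<inter> L = {}"
    and maps: "maps_into K S S" "maps_into L S S'" "S' \<subseteq> S"
    and fibres: "SD_fibres C (action S) (lstar K)" "SD_fibres C (action S) L"
    and image: "\<And>R. bounded_sync_delay R \<Longrightarrow> maps_into R S' S'
      \<Longrightarrow> SD_fibres C (action S') R \<Longrightarrow> SD_fibres C (action S') (lstar R)"
  shows "SD_fibres C (action S) (lstar (K \<union> L))"
proof -
  let ?R = "lstar K @@ L"
  note code = bounded_sync_delay_prefix_code[OF delay]
  note K_star = maps_into_lstar[OF maps(1)]
  have R: "maps_into ?R S S'"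
    by (rule maps_into_conc[OF K_star maps(2)])
  have R_fibres: "SD_fibres C (action S) ?R"
    using fibres unambiguous_return_words[OF code disjoint] K_star by (rule SD_fibres_action_conc)
  have "SD_fibres C (action S') (lstar ?R)"
  proof (rule image)
    show "bounded_sync_delay ?R"
      using delay disjoint by (rule bounded_sync_delay_return_words)
    show "maps_into ?R S' S'"
      using R maps(3) by (blast intro: maps_into_mono)
    show "SD_fibres C (action S') ?R"
      using R_fibres maps(3) by (rule SD_fibres_action_subset)
  qed
  then have "SD_fibres C (action S) (lstar ?R)"
    by (rule SD_fibres_lstar_shrinking[OF prefix_code_return_words[OF code disjoint] R maps(3)
          R_fibres])
  moreover have "maps_into (lstar ?R) S S"
    using R maps(3) by (blast intro: maps_into_lstar maps_into_mono)
  ultimately have "SD_fibres C (action S) (lstar ?R @@ lstar K)"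
    by (rule SD_fibres_action_conc[OF _ fibres(1) unambiguous_lstar_return_words[OF code disjoint]])
  then show ?thesis
    by (simp add: lstar_Un_denest)
qed

lemma SD_fibres_lstar_step:
  fixes r :: "'a::finite list" and S :: "'a list set set"
  defines "S' \<equiv> lquot r ` S"
  assumes delay: "bounded_sync_delay P" and invariant: "maps_into P S S"
    and fibres: "SD_fibres C (action S) P" and r: "r \<in> P"
    and fewer_actions: "\<And>K. action S ` K \<subset> action S ` P \<Longrightarrow> bounded_sync_delay K
      \<Longrightarrow> maps_into K S S \<Longrightarrow> SD_fibres C (action S) K \<Longrightarrow> SD_fibres C (action S) (lstar K)"
    and image: "\<And>R. bounded_sync_delay R \<Longrightarrow> maps_into R S' S'
      \<Longrightarrow> SD_fibres C (action S') R \<Longrightarrow> SD_fibres C (action S') (lstar R)"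
  shows "SD_fibres C (action S) (lstar P)"
proof -
  define K where "K = {w \<in> P. action S w \<noteq> action S r}"
  define R where "R = {w \<in> P. action S w = action S r}"
  have P: "P = K \<union> R" and disjoint: "K \<inter> R = {}"
    by (auto simp: K_def R_def)
  have maps: "maps_into K S S" "maps_into R S S'"
    using invariant by (auto simp: maps_into_def K_def R_def S'_def action_eq_iff)
  have "S' \<subseteq> S"
    using invariant r by (auto simp: S'_def dest: maps_intoD)
  moreover have "SD_fibres C (action S) (lstar K)"
  proof (rule fewer_actions[OF _ _ maps(1)])
    have "action S r \<in> action S ` P" "action S r \<notin> action S ` K"
      using r by (auto simp: K_def)
    then show "action S ` K \<subset> action S ` P"
      using P by blast
    show "bounded_sync_delay K"
      using delay P by (blast intro: bounded_sync_delay_subset)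
    show "SD_fibres C (action S) K"
      unfolding K_def by (rule SD_fibres_restrict[OF fibres])
  qed
  moreover have "SD_fibres C (action S) R"
    unfolding R_def by (rule SD_fibres_restrict[OF fibres])
  ultimately show ?thesis
    unfolding P using image by (rule SD_fibres_lstar_Un[OF delay[unfolded P] disjoint maps])
qed


section \<open>From the star-free closure to bounded synchronization delay\<close>

context relatively_aperiodic
begin

lemma SD_fibres_lstar_permutations:
  assumes "finite S" "S \<subseteq> lquots L" and bij: "\<forall>w\<in>P. bij_betw (lquot w) S S"
    and "P \<in> SD C" "bounded_sync_delay P"
  shows "SD_fibres C (action S) (lstar P)"
  unfolding SD_fibres_def
proof (intro conjI allI)
  have "maps_into P S S"
    using bij by (auto simp: maps_into_def dest: bij_betw_apply)
  then show "finite (action S ` lstar P)"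
    by (intro finite_action assms(1) maps_into_lstar)
  fix g
  define W where "W = {v. \<exists>u\<in>lstar P. action S u = g \<and> action T u = action T v}"
  have "W \<in> C"
    by (rule saturated_in_prevariety) (auto simp: W_def)
  then have "lstar P \<inter> W \<in> SD C"
    by (intro SD_inter SD_lstar assms)
  moreover have "lstar P \<inter> W = {w \<in> lstar P. action S w = g}"
  proof (intro equalityI subsetI)
    fix w assume w: "w \<in> lstar P \<inter> W"
    then obtain u where u: "u \<in> lstar P" "action S u = g" "action T u = action T w"
      by (auto simp: W_def)
    then show "w \<in> {w \<in> lstar P. action S w = g}"
      using permutations_determined[OF assms(2) bij u(1) _ u(3)] w by simp
  qed (auto simp: W_def)
  ultimately show "{w \<in> lstar P. action S w = g} \<in> SD C"
    by simp
qed

lemma SD_fibres_lstar: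
  assumes "finite S" "S \<subseteq> lquots L" "bounded_sync_delay P" "maps_into P S S"
    and "SD_fibres C (action S) P"
  shows "SD_fibres C (action S) (lstar P)"
  using assms
proof (induction S arbitrary: P rule: finite_psubset_induct)
  case (psubset S)
  note smaller_set = psubset.IH and S = psubset.hyps psubset.prems(1)
  from SD_fibres_finite[OF psubset.prems(4)] psubset.prems(2-4) show ?case
  proof (induction "action S ` P" arbitrary: P rule: finite_psubset_induct)
    case (psubset P)
    note invariant = psubset.prems(2)
    show ?case
    proof (cases "\<forall>w\<in>P. S \<subseteq> lquot w ` S")
      case True
      then have "\<forall>w\<in>P. bij_betw (lquot w) S S"
        using invariant finite_surj_inj[OF S(1)] by (fastforce simp: bij_betw_def maps_into_def)
      then show ?thesis
        using S psubset.prems(1,3) SD_fibres_in_SD by (intro SD_fibres_lstar_permutations) auto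
    next
      case False
      then obtain r where r: "r \<in> P" "\<not> S \<subseteq> lquot r ` S"
        by blast
      then have image: "lquot r ` S \<subset> S"
        using invariant by (auto dest: maps_intoD)
      from psubset.prems r(1) psubset.hyps(2) show ?thesis
      proof (rule SD_fibres_lstar_step)
        show "SD_fibres C (action (lquot r ` S)) (lstar K)"
          if "bounded_sync_delay K" "maps_into K (lquot r ` S) (lquot r ` S)"
            "SD_fibres C (action (lquot r ` S)) K" for K
          using smaller_set[OF image _ that] image S(2) by simp
      qed
    qed
  qed
qed

end

lemma SF_subset_SD:
  assumes "prevariety C"
  shows "SF C \<subseteq> SD C"
proof
  fix L assume L: "L \<in> SF C"
  then obtain T where "relatively_aperiodic C T L"
    using SF_relatively_aperiodic[OF assms] by blast
  then interpret relatively_aperiodic C T L .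
  have "SD_fibres C (action (lquots L)) (lstar (range (\<lambda>a. [a])))"
    using SF_finite_lquots[OF prevariety_finite_lquots[OF assms] L] sync_delay_letters
    by (intro SD_fibres_lstar maps_into_lquots SD_fibres_letters)
      (auto simp: bounded_sync_delay_iff)
  then have "{w \<in> UNIV. [] \<in> action (lquots L) w L} \<in> SD C"
    unfolding lstar_letters by (rule SD_fibres_Collect)
  also have "{w \<in> UNIV. [] \<in> action (lquots L) w L} = L"
    using self_in_lquots[of L] by (simp add: lquot_def)
  finally show "L \<in> SD C" .
qed

theorem theorem4p10:
  fixes C :: "('a::finite) list set set"
  assumes "prevariety C"
  shows "SD C = SF C"
  using SD_subset_SF[OF assms] SF_subset_SD[OF assms] by (rule subset_antisym)

end
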